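(* As $X\to\infty$, $$\#\Omega_1(X)=\frac{1}{4\zeta(2)}X^4+O(X^3\log X),$$ and in particular $\#\Omega_1(X)\sim\frac{1}{4\zeta(2)}X^4$.
   Context: For coprime positive integers $p,q$, $\Delta_{p,q}(t)=\frac{(t^{pq}-1)(t-1)}{(t^p-1)(t^q-1)}$ is the Alexander polynomial of the torus knot $T_{p,q}$. For $X>0$, $\Omega_1(X)$ is the set of all pairs $(T_{p,q},\alpha)$, where $(p,q)$ is an ordered pair of coprime positive integers with $\max\{p,q\}\le X$ (identified with $T_{p,q}$) and $\alpha\in\mathbb{C}$ is a root of $\Delta_{p,q}(t)$. $\zeta(2)=\pi^2/6$; $f(X)\sim h(X)$ means $f(X)/h(X)\to1$; $f(X)=g(X)+O(h(X))$ has its usual meaning: $|f(X)-g(X)|\le C\,h(X)$ for some constant $C$ and all sufficiently large $X$. *)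

theory Defs
  imports
    "HOL-Analysis.Analysis"
    "HOL-Computational_Algebra.Computational_Algebra"
    "HOL-Library.Landau_Symbols"
begin

definition t_pow_minus_1 :: "nat \<Rightarrow> complex poly" where
  "t_pow_minus_1 n = monom 1 n - 1"

text \<open>For coprime positive \<open>p\<close> and \<open>q\<close> the Euclidean division \<open>div\<close> below is exact, see
  \<open>alexander_poly_exact\<close>; other arguments are never used.\<close>

definition alexander_poly :: "nat \<Rightarrow> nat \<Rightarrow> complex poly" where
  "alexander_poly p q =
     (t_pow_minus_1 (p * q) * t_pow_minus_1 1) div (t_pow_minus_1 p * t_pow_minus_1 q)"

definition Omega1 :: "real \<Rightarrow> ((nat \<times> nat) \<times> complex) set" where
  "Omega1 X = {((p, q), \<alpha>) | p q \<alpha>.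
     p > 0 \<and> q > 0 \<and> coprime p q \<and> real (max p q) \<le> X \<and> poly (alexander_poly p q) \<alpha> = 0}"

definition zeta :: "nat \<Rightarrow> real" where
  "zeta s = (\<Sum>n. 1 / real (Suc n) ^ s)"

lemma zeta_2: "zeta 2 = pi\<^sup>2 / 6"
  using inverse_squares_sums unfolding zeta_def by (simp add: sums_iff add.commute)

lemma t_pow_minus_1_dvd_mult: "t_pow_minus_1 p dvd t_pow_minus_1 (p * k)"
proof -
  have "t_pow_minus_1 (p * k) = monom 1 p ^ k - 1"
    by (simp add: t_pow_minus_1_def monom_power mult.commute)
  also have "\<dots> = (monom 1 p - 1) * (\<Sum>i<k. monom 1 p ^ i)"
    by (rule power_diff_1_eq)
  finally show ?thesis by (simp add: t_pow_minus_1_def)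
qed

lemma t_pow_minus_1_neq_0: "n > 0 \<Longrightarrow> t_pow_minus_1 n \<noteq> 0"
proof
  assume "n > 0" "t_pow_minus_1 n = 0"
  then have "coeff (t_pow_minus_1 n) n = 0" by simp
  with \<open>n > 0\<close> show False by (simp add: t_pow_minus_1_def coeff_1)
qed

lemma t_pow_minus_1_quotients_bezout:
  assumes "p > 0" and "coprime p q"
    and A: "t_pow_minus_1 p = t_pow_minus_1 1 * A" and B: "t_pow_minus_1 q = t_pow_minus_1 1 * B"
  shows "\<exists>U V. A * U - B * V = 1"
proof -
  obtain a b where ab: "p * a = q * b + 1"
    using bezout_nat[of p q] assms(1,2) by auto
  obtain U V where UV: "t_pow_minus_1 (p * a) = t_pow_minus_1 p * U"
      "t_pow_minus_1 (q * b) = t_pow_minus_1 q * V"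
    using t_pow_minus_1_dvd_mult by (metis dvdE)
  have "t_pow_minus_1 (p * a) - monom 1 1 * t_pow_minus_1 (q * b) = t_pow_minus_1 1"
    unfolding ab by (simp add: t_pow_minus_1_def right_diff_distrib mult_monom)
  then have "t_pow_minus_1 1 * (A * U - B * (monom 1 1 * V)) = t_pow_minus_1 1 * 1"
    unfolding UV A B by (simp add: algebra_simps)
  then have "A * U - B * (monom 1 1 * V) = 1"
    using t_pow_minus_1_neq_0[of 1] by (simp only: mult_cancel_left) auto
  then show ?thesis by blast
qed

lemma alexander_poly_exact:
  assumes "p > 0" "q > 0" "coprime p q"
  shows "alexander_poly p q * (t_pow_minus_1 p * t_pow_minus_1 q) =
    t_pow_minus_1 (p * q) * t_pow_minus_1 1"
proof -
  let ?u = "t_pow_minus_1 1"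
  obtain A B C where ABC: "t_pow_minus_1 p = ?u * A" "t_pow_minus_1 q = ?u * B"
      "t_pow_minus_1 (p * q) = ?u * C"
    using t_pow_minus_1_dvd_mult[of 1] by (metis dvdE nat_mult_1)
  have "?u * A dvd ?u * C" "?u * B dvd ?u * C"
    using ABC t_pow_minus_1_dvd_mult[of p q] t_pow_minus_1_dvd_mult[of q p]
    by (simp_all add: mult.commute)
  then have "A dvd C" "B dvd C"
    using t_pow_minus_1_neq_0[of 1] by (auto simp only: dvd_mult_cancel_left)
  obtain U V where UV: "A * U - B * V = 1"
    using t_pow_minus_1_quotients_bezout[OF assms(1,3) ABC(1,2)] by blast
  have "A * B dvd A * C" "A * B dvd C * B"
    using \<open>A dvd C\<close> \<open>B dvd C\<close> by (auto intro: mult_dvd_mono)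
  then have "A * B dvd A * C * U - C * B * V"
    by (rule dvd_diff[OF dvd_mult2 dvd_mult2])
  also have "A * C * U - C * B * V = C * (A * U - B * V)"
    by (simp add: algebra_simps)
  finally have "A * B dvd C" by (simp add: UV)
  then have "(?u * ?u) * (A * B) dvd (?u * ?u) * C"
    by (rule mult_dvd_mono[OF dvd_refl])
  then have "t_pow_minus_1 p * t_pow_minus_1 q dvd t_pow_minus_1 (p * q) * ?u"
    unfolding ABC by (simp only: ac_simps)
  then show ?thesis
    unfolding alexander_poly_def by (rule dvd_div_mult_self)
qed

text \<open>Hence \<open>card (Omega1 X)\<close> is a genuine count.\<close>

lemma finite_Omega1: "finite (Omega1 X)"
proof (rule finite_subset)
  let ?N = "{p. 0 < p \<and> p \<le> nat \<lfloor>X\<rfloor>}"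
  let ?I = "{(p, q). p \<in> ?N \<and> q \<in> ?N \<and> coprime p q}"
  show "Omega1 X \<subseteq> (SIGMA pq:?I. {\<alpha>. poly (alexander_poly (fst pq) (snd pq)) \<alpha> = 0})"
    by (auto simp: Omega1_def le_nat_floor)
  have "finite ?I"
    by (rule finite_subset[of _ "?N \<times> ?N"]) auto
  moreover have "alexander_poly p q \<noteq> 0" if "p > 0" "q > 0" "coprime p q" for p q
  proof
    assume "alexander_poly p q = 0"
    then have "t_pow_minus_1 (p * q) * t_pow_minus_1 1 = 0"
      using alexander_poly_exact[OF that] by simp
    then show False
      using that t_pow_minus_1_neq_0[of 1] t_pow_minus_1_neq_0[of "p * q"] by auto
  qed
  ultimately show "finite (SIGMA pq:?I. {\<alpha>. poly (alexander_poly (fst pq) (snd pq)) \<alpha> = 0})"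
    by (intro finite_SigmaI) (auto intro: poly_roots_finite)
qed

end

theory Submission
  imports Defs "HOL-Real_Asymp.Real_Asymp"
begin

text \<open>
  The polynomial \<open>\<Delta>\<^sub>p\<^sub>,\<^sub>q\<close> divides the squarefree polynomial \<open>t\<^sup>p\<^sup>q - 1\<close>, so it has exactly
  \<open>(p - 1) (q - 1)\<close> roots, and up to an error \<open>O(X\<^sup>3)\<close> the count is the sum of \<open>p q\<close> over coprime
  pairs. Moebius inversion turns that sum into \<open>\<Sum>d \<le> X. \<mu>(d) d\<^sup>2 T(\<lfloor>X/d\<rfloor>)\<^sup>2\<close> with
  \<open>T(m) = m (m + 1) / 2\<close>. Replacing \<open>T(\<lfloor>X/d\<rfloor>)\<^sup>2\<close> by \<open>(X/d)\<^sup>4 / 4\<close> costs \<open>O(X\<^sup>3/d)\<close> per summand,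
  hence \<open>O(X\<^sup>3 log X)\<close> in total, and completing the series \<open>\<Sum> \<mu>(d) / d\<^sup>2 = 1 / \<zeta>(2)\<close>
  costs \<open>O(X\<^sup>3)\<close>.
\<close>

section \<open>Roots of the Alexander polynomial\<close>

lemma degree_t_pow_minus_1: "degree (t_pow_minus_1 n) = n"
proof (cases "n = 0")
  case False
  have "degree (monom 1 n + (- 1 :: complex poly)) = degree (monom (1 :: complex) n)"
    using False by (intro degree_add_eq_left) (simp add: degree_monom_eq)
  then show ?thesis by (simp add: t_pow_minus_1_def degree_monom_eq)
qed (simp add: t_pow_minus_1_def)

text \<open>A multiple root would also be a root of the derivative \<open>n t^(n-1)\<close>, which
  can vanish only at 0, and 0 is not a root of \<open>t^n - 1\<close>.\<close>

lemma rsquarefree_t_pow_minus_1: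
  assumes "n > 0"
  shows "rsquarefree (t_pow_minus_1 n)"
  using assms
  by (auto simp: rsquarefree_roots t_pow_minus_1_def pderiv_diff pderiv_monom poly_monom power_0_left)

lemma rsquarefree_dvd:
  assumes "p dvd q" "rsquarefree q"
  shows "rsquarefree p"
proof -
  have "q \<noteq> 0" and q: "order a q \<le> 1" for a
    using assms(2) by (auto simp: rsquarefree_def le_Suc_eq)
  then have "order a p \<le> 1" for a
    using dvd_imp_order_le[OF \<open>q \<noteq> 0\<close> assms(1), of a] order.trans by blast
  then show ?thesis
    using \<open>q \<noteq> 0\<close> assms(1) by (auto simp: rsquarefree_def le_Suc_eq)
qed

text \<open>Over the complex numbers a squarefree polynomial is a constant times the product of
  \<open>t - z\<close> over its distinct roots \<open>z\<close>; comparing degrees counts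
  them.\<close>

lemma card_roots_rsquarefree:
  fixes p :: "complex poly"
  assumes "rsquarefree p"
  shows "card {z. poly p z = 0} = degree p"
proof -
  have "p \<noteq> 0" using assms by (simp add: rsquarefree_def)
  then have "degree p = degree (\<Prod>z|poly p z = 0. [:-z, 1:])"
    by (metis complex_poly_decompose_rsquarefree[OF assms] degree_smult_eq leading_coeff_0_iff)
  also have "\<dots> = (\<Sum>z|poly p z = 0. degree [:-z, 1:])"
    by (rule degree_prod_sum_eq) auto
  finally show ?thesis by simp
qed

text \<open>Cancelling \<open>t - 1\<close> in the exact quotient identity exhibits the polynomial
  as a divisor of \<open>t^(pq) - 1\<close>, so its roots are simple. The same identity gives the
  degree \<open>pq + 1 - p - q\<close>.\<close>

lemma card_roots_alexander_poly:
  assumes "p > 0" "q > 0" "coprime p q"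
  shows "card {\<alpha>. poly (alexander_poly p q) \<alpha> = 0} = (p - 1) * (q - 1)"
proof -
  let ?D = "alexander_poly p q" and ?u = "t_pow_minus_1 1"
  obtain A where A: "t_pow_minus_1 p = ?u * A"
    using t_pow_minus_1_dvd_mult[of 1 p] by (auto elim: dvdE)
  have nz: "t_pow_minus_1 n \<noteq> 0" if "n > 0" for n using t_pow_minus_1_neq_0 that by blast
  have "?u * (?D * (A * t_pow_minus_1 q)) = ?u * t_pow_minus_1 (p * q)"
    using alexander_poly_exact[OF assms] by (simp add: A algebra_simps)
  then have "?D dvd t_pow_minus_1 (p * q)"
    using nz[of 1] by (metis dvd_triv_left mult_cancel_left zero_less_one)
  then have "rsquarefree ?D"
    by (rule rsquarefree_dvd) (use assms in \<open>simp add: rsquarefree_t_pow_minus_1\<close>)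
  moreover have "degree ?D + (p + q) = p * q + 1"
  proof -
    have "?D \<noteq> 0" using \<open>rsquarefree ?D\<close> by (simp add: rsquarefree_def)
    then have "degree (?D * (t_pow_minus_1 p * t_pow_minus_1 q)) = degree ?D + (p + q)"
      using nz assms by (simp add: degree_mult_eq degree_t_pow_minus_1)
    moreover have "degree (t_pow_minus_1 (p * q) * ?u) = p * q + 1"
      using nz[of "p * q"] nz[of 1] assms by (simp add: degree_mult_eq degree_t_pow_minus_1)
    ultimately show ?thesis by (simp add: alexander_poly_exact[OF assms])
  qed
  \<comment> \<open>Successors resolve the truncated subtractions in
    \<open>(p - 1) * (q - 1)\<close>.\<close>
  moreover obtain a b where "p = Suc a" "q = Suc b" using assms by (metis gr0_conv_Suc)
  ultimately show ?thesis by (simp add: card_roots_rsquarefree)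
qed

section \<open>Reduction to a sum over coprime pairs\<close>

definition coprime_pairs :: "nat \<Rightarrow> (nat \<times> nat) set" where
  "coprime_pairs N = {(p, q). p \<in> {1..N} \<and> q \<in> {1..N} \<and> coprime p q}"

lemma coprime_pairs_subset: "coprime_pairs N \<subseteq> {1..N} \<times> {1..N}"
  by (auto simp: coprime_pairs_def)

lemma finite_coprime_pairs: "finite (coprime_pairs N)"
  using coprime_pairs_subset by (rule finite_subset) simp

lemma card_Omega1:
  "card (Omega1 X) = (\<Sum>(p, q)\<in>coprime_pairs (nat \<lfloor>X\<rfloor>). (p - 1) * (q - 1))"
proof -
  \<comment> \<open>For negative \<open>X\<close> the right-hand bound is 0, and
    \<open>p > 0\<close> makes both sides false.\<close>
  have bound: "real (max p q) \<le> X \<longleftrightarrow> p \<le> nat \<lfloor>X\<rfloor> \<and> q \<le> nat \<lfloor>X\<rfloor>" if "p > 0" for p q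
  proof -
    have "real (max p q) \<le> X \<longleftrightarrow> int (max p q) \<le> \<lfloor>X\<rfloor>" by (simp only: le_floor_iff of_int_of_nat_eq)
    then show ?thesis using that by linarith
  qed
  let ?R = "\<lambda>x. {\<alpha>. poly (alexander_poly (fst x) (snd x)) \<alpha> = 0}"
  have "Omega1 X = (SIGMA x:coprime_pairs (nat \<lfloor>X\<rfloor>). ?R x)"
    by (auto simp: Omega1_def coprime_pairs_def bound Suc_le_eq simp del: of_nat_max)
  moreover have "finite (?R x)" if "x \<in> coprime_pairs (nat \<lfloor>X\<rfloor>)" for x
  proof -
    \<comment> \<open>The root set over \<open>x\<close> is the preimage of the finite set
      \<open>Omega1 X\<close> under the injective map \<open>Pair x\<close>.\<close>
    have "finite (Pair x -` Omega1 X)" by (intro finite_vimageI finite_Omega1) (simp add: inj_def)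
    then show ?thesis using that calculation by (simp add: Sigma_def vimage_def)
  qed
  ultimately have "card (Omega1 X) = (\<Sum>x\<in>coprime_pairs (nat \<lfloor>X\<rfloor>). card (?R x))"
    by (simp add: card_SigmaI finite_coprime_pairs)
  also have "\<dots> = (\<Sum>(p, q)\<in>coprime_pairs (nat \<lfloor>X\<rfloor>). (p - 1) * (q - 1))"
    by (intro sum.cong) (auto simp: coprime_pairs_def card_roots_alexander_poly)
  finally show ?thesis .
qed

section \<open>The Moebius function and inversion of the coprimality condition\<close>

definition moebius_mu :: "nat \<Rightarrow> real" where
  "moebius_mu n = (if squarefree n then (- 1) ^ card (prime_factors n) else 0)"

lemma abs_moebius_le: "\<bar>moebius_mu n\<bar> \<le> 1"
  by (simp add: moebius_mu_def power_abs)

text \<open>A new prime adds one element to \<open>prime_factors\<close> and does not affect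
  squarefreeness, so only the sign flips.\<close>

lemma moebius_prime_mult:
  assumes "prime p" "\<not> p dvd n"
  shows "moebius_mu (p * n) = - moebius_mu n"
proof -
  have "n > 0" using assms(2) by (cases "n = 0") auto
  have "coprime p n" using assms by (simp add: prime_imp_coprime)
  then have "squarefree (p * n) \<longleftrightarrow> squarefree n"
    using assms(1) by (meson squarefree_mult_coprime squarefree_multD(2) squarefree_prime)
  moreover have "prime_factors (p * n) = insert p (prime_factors n)"
    using assms \<open>n > 0\<close> by (simp add: prime_factors_product prime_prime_factors)
  moreover have "p \<notin> prime_factors n"
    using assms(2) by auto
  ultimately show ?thesis by (simp add: moebius_mu_def)
qed

lemma sum_moebius_mu_divisors:
  assumes "n > 0"
  shows "(\<Sum>d | d dvd n. moebius_mu d) = (if n = 1 then 1 else 0)"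
proof (cases "n = 1")
  case True
  then show ?thesis by (simp add: moebius_mu_def)
next
  case False
  then obtain p where p: "prime p" "p dvd n" using prime_factor_nat by blast
  \<comment> \<open>\<open>d \<mapsto> p d\<close> pairs off the divisors not divisible by \<open>p\<close> with those divisible by \<open>p\<close> exactly
    once; \<open>\<mu>\<close> changes sign under it and vanishes on the remaining divisors.\<close>
  let ?A = "{d. d dvd n \<and> \<not> p dvd d}" and ?B = "{d. d dvd n \<and> p dvd d \<and> \<not> p\<^sup>2 dvd d}"
  have "p > 0" using p by (simp add: prime_gt_0_nat)
  have fin: "finite {d. d dvd n}" using assms by simp
  have zero: "moebius_mu d = 0" if "p\<^sup>2 dvd d" for d
    using that p(1) by (auto simp: moebius_mu_def dest: squarefreeD)
  have "(\<Sum>d | d dvd n. moebius_mu d) = (\<Sum>d\<in>?A \<union> ?B. moebius_mu d)"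
    using zero by (intro sum.mono_neutral_right fin) auto
  also have "\<dots> = (\<Sum>d\<in>?A. moebius_mu d) + (\<Sum>d\<in>?B. moebius_mu d)"
    using fin by (intro sum.union_disjoint) auto
  also have "(\<Sum>d\<in>?B. moebius_mu d) = (\<Sum>d\<in>?A. moebius_mu (p * d))"
  proof (rule sum.reindex_bij_witness[of _ "\<lambda>d. p * d" "\<lambda>d. d div p"])
    fix d assume d: "d \<in> ?A"
    have "p * d dvd n"
      using d p by (intro divides_mult) (auto simp: prime_imp_coprime)
    moreover have "\<not> p\<^sup>2 dvd p * d"
      using d \<open>p > 0\<close> by (simp add: power2_eq_square)
    ultimately show "p * d \<in> ?B" by simp
    show "p * d div p = d" using \<open>p > 0\<close> by simp
  next
    fix d assume d: "d \<in> ?B"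
    then obtain e where e: "d = p * e" by (auto elim: dvdE)
    then show "d div p \<in> ?A" "p * (d div p) = d" "moebius_mu (p * (d div p)) = moebius_mu d"
      using d \<open>p > 0\<close> by (auto simp: power2_eq_square dest: dvd_mult_right)
  qed
  also have "\<dots> = - (\<Sum>d\<in>?A. moebius_mu d)"
    using p(1) by (simp add: moebius_prime_mult sum_negf)
  finally show ?thesis using False by simp
qed

text \<open>The multiples of \<open>d\<close> in \<open>{1..N}\<close> are \<open>d * i\<close> with
  \<open>i\<close> in \<open>{1..N div d}\<close>.\<close>

lemma sum_divisible:
  assumes "d > 0"
  shows "(\<Sum>n=1..N. if d dvd n then real n else 0) = real d * (\<Sum>i=1..N div d. real i)"
proof -
  have "(\<Sum>n=1..N. if d dvd n then real n else 0) = (\<Sum>n | n \<in> {1..N} \<and> d dvd n. real n)"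
    by (rule sum.inter_filter [symmetric]) simp
  also have "\<dots> = (\<Sum>i=1..N div d. real d * real i)"
  proof (rule sum.reindex_bij_witness[of _ "\<lambda>i. d * i" "\<lambda>n. n div d"])
    fix n assume "n \<in> {n \<in> {1..N}. d dvd n}"
    then show "d * (n div d) = n" "n div d \<in> {1..N div d}" "real d * real (n div d) = real n"
      using assms by (auto simp: div_le_mono elim!: dvdE)
  next
    fix i assume "i \<in> {1..N div d}"
    then show "d * i div d = i" "d * i \<in> {n \<in> {1..N}. d dvd n}"
      using assms by (auto simp: less_eq_div_iff_mult_less_eq mult.commute)
  qed
  finally show ?thesis by (simp add: sum_distrib_left)
qed

text \<open>Coprimality is detected by summing \<open>moebius_mu\<close> over the divisors of
  \<open>gcd p q\<close>. After exchanging sums, for fixed \<open>d\<close> the sum over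
  \<open>p\<close> and \<open>q\<close> factors into a square.\<close>

lemma sum_coprime_pairs:
  "(\<Sum>(p, q)\<in>coprime_pairs N. real p * real q) =
     (\<Sum>d=1..N. moebius_mu d * (real d * (\<Sum>i=1..N div d. real i))\<^sup>2)"
proof -
  \<comment> \<open>The weight absorbs the divisibility condition: \<open>w d p * w d q\<close> is
    nonzero only if \<open>d\<close> divides \<open>gcd p q\<close>.\<close>
  define w where "w d n = (if d dvd n then real n else 0)" for d n :: nat
  have coprime_sum: "(\<Sum>d=1..N. moebius_mu d * w d p * w d q) = (if coprime p q then real p * real q else 0)"
    if "p \<in> {1..N}" "q \<in> {1..N}" for p q
  proof -
    have "(\<Sum>d=1..N. moebius_mu d * w d p * w d q) =
        (\<Sum>d=1..N. if d dvd gcd p q then moebius_mu d * (real p * real q) else 0)"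
      by (intro sum.cong) (auto simp: w_def)
    also have "\<dots> = (\<Sum>d | d \<in> {1..N} \<and> d dvd gcd p q. moebius_mu d * (real p * real q))"
      by (rule sum.inter_filter [symmetric]) simp
    \<comment> \<open>Divisors of \<open>gcd p q\<close> are positive and at most \<open>p\<close>,
      hence at most \<open>N\<close>.\<close>
    also have "{d. d \<in> {1..N} \<and> d dvd gcd p q} = {d. d dvd gcd p q}"
      using that by (auto dest: dvd_imp_le simp: Suc_le_eq intro: Nat.gr0I)
    also have "(\<Sum>d | d dvd gcd p q. moebius_mu d * (real p * real q)) =
        (if gcd p q = 1 then 1 else 0) * (real p * real q)"
      using that by (simp only: sum_distrib_right [symmetric]) (subst sum_moebius_mu_divisors, auto)
    finally show ?thesis by (auto simp: coprime_iff_gcd_eq_1)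
  qed
  have "coprime_pairs N = {x \<in> {1..N} \<times> {1..N}. coprime (fst x) (snd x)}"
    by (auto simp: coprime_pairs_def)
  then have "(\<Sum>(p, q)\<in>coprime_pairs N. real p * real q) =
      (\<Sum>(p, q)\<in>{1..N} \<times> {1..N}. if coprime p q then real p * real q else 0)"
    by (simp add: sum.inter_filter case_prod_unfold)
  also have "\<dots> = (\<Sum>p=1..N. \<Sum>q=1..N. \<Sum>d=1..N. moebius_mu d * w d p * w d q)"
    unfolding sum.cartesian_product [symmetric] by (intro sum.cong refl coprime_sum [symmetric])
  also have "\<dots> = (\<Sum>p=1..N. \<Sum>d=1..N. \<Sum>q=1..N. moebius_mu d * w d p * w d q)"
    by (intro sum.cong refl sum.swap)
  also have "\<dots> = (\<Sum>d=1..N. \<Sum>p=1..N. \<Sum>q=1..N. moebius_mu d * w d p * w d q)"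
    by (rule sum.swap)
  also have "\<dots> = (\<Sum>d=1..N. moebius_mu d * (\<Sum>n=1..N. w d n)\<^sup>2)"
    unfolding power2_eq_square sum_product by (simp add: sum_distrib_left mult.assoc)
  also have "\<dots> = (\<Sum>d=1..N. moebius_mu d * (real d * (\<Sum>i=1..N div d. real i))\<^sup>2)"
    by (intro sum.cong refl) (simp add: w_def sum_divisible del: One_nat_def)
  finally show ?thesis .
qed

section \<open>The Moebius series at 2 and its tail\<close>

lemma has_sum_inverse_squares: "((\<lambda>n. 1 / (real n)\<^sup>2) has_sum zeta 2) {0<..}"
proof -
  have sums: "(\<lambda>n. 1 / (real (Suc n))\<^sup>2) sums zeta 2"
    using inverse_squares_sums by (simp add: zeta_2 add.commute)
  then have "((\<lambda>n. 1 / (real (Suc n))\<^sup>2) has_sum zeta 2) UNIV"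
    by (intro norm_summable_imp_has_sum) (auto simp: sums_iff)
  then show ?thesis
    by (subst has_sum_reindex_bij_witness[where T = UNIV and i = Suc and j = "\<lambda>n. n - 1"
          and h = "\<lambda>n. 1 / (real (Suc n))\<^sup>2"]) auto
qed

text \<open>Absolute convergence lets the product of this series with \<open>zeta 2\<close> be
  regrouped by \<open>n = d * e\<close>. The divisor sums of \<open>moebius_mu\<close> then leave
  only \<open>n = 1\<close>, so the product is 1.\<close>

lemma has_sum_moebius: "((\<lambda>d. moebius_mu d / (real d)\<^sup>2) has_sum 1 / zeta 2) {0<..}"
proof -
  let ?P = "{0::nat<..}"
  let ?m = "\<lambda>d. moebius_mu d / (real d)\<^sup>2"
  let ?F = "\<lambda>(d, e). ?m d * (1 / (real e)\<^sup>2)"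
  have zsum: "(\<lambda>n. 1 / (real n)\<^sup>2) summable_on ?P"
    using has_sum_inverse_squares by (rule has_sum_imp_summable)
  have "(\<lambda>d. norm (?m d)) summable_on ?P"
    by (rule Infinite_Sum.abs_summable_on_comparison_test'[OF zsum])
       (simp add: abs_moebius_le divide_right_mono)
  then have "?m summable_on ?P" by (rule abs_summable_summable)
  then obtain M where M: "(?m has_sum M) ?P" by (auto simp: summable_on_def)
  \<comment> \<open>This double series dominates \<open>?F\<close>, because
    \<open>moebius_mu\<close> is bounded by 1.\<close>
  have "(\<lambda>(d, e). 1 / (real d)\<^sup>2 * (1 / (real e)\<^sup>2)) summable_on ?P \<times> ?P"
  proof (rule summable_on_SigmaI)
    show "((\<lambda>e. case (d, e) of (d, e) \<Rightarrow> 1 / (real d)\<^sup>2 * (1 / (real e)\<^sup>2)) has_sum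
        1 / (real d)\<^sup>2 * zeta 2) ?P" for d
      unfolding prod.case by (rule has_sum_cmult_right[OF has_sum_inverse_squares])
    show "(\<lambda>d. 1 / (real d)\<^sup>2 * zeta 2) summable_on ?P"
      by (rule summable_on_cmult_left[OF zsum])
  qed auto
  then have "(\<lambda>x. norm (?F x)) summable_on ?P \<times> ?P"
  proof (rule Infinite_Sum.abs_summable_on_comparison_test')
    fix x assume "x \<in> ?P \<times> ?P"
    show "norm (?F x) \<le> (case x of (d, e) \<Rightarrow> 1 / (real d)\<^sup>2 * (1 / (real e)\<^sup>2))"
      by (auto simp: abs_mult abs_moebius_le case_prod_unfold intro!: divide_right_mono)
  qed
  then have summable: "?F summable_on ?P \<times> ?P" by (rule abs_summable_summable)
  have "(?F has_sum M * zeta 2) (?P \<times> ?P)"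
  proof (rule has_sum_SigmaI[OF _ _ summable])
    show "((\<lambda>e. ?F (d, e)) has_sum ?m d * zeta 2) ?P" for d
      unfolding prod.case by (rule has_sum_cmult_right[OF has_sum_inverse_squares])
    show "((\<lambda>d. ?m d * zeta 2) has_sum M * zeta 2) ?P"
      by (rule has_sum_cmult_left[OF M])
  qed
  \<comment> \<open>The pair \<open>(d, e)\<close> becomes the number \<open>n = d * e\<close>
    together with its divisor \<open>d\<close>.\<close>
  also have "?this \<longleftrightarrow>
      ((\<lambda>(n, d). moebius_mu d / (real n)\<^sup>2) has_sum M * zeta 2) (SIGMA n:?P. {d. d dvd n})"
    by (rule has_sum_reindex_bij_witness[where i = "\<lambda>(n, d). (d, n div d)" and j = "\<lambda>(d, e). (d * e, d)"])
       (auto simp: power_mult_distrib intro: Nat.gr0I elim!: dvdE)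
  finally have "((\<lambda>n. (if n = 1 then 1 else 0) / (real n)\<^sup>2) has_sum M * zeta 2) ?P"
  proof (rule has_sum_Sigma')
    fix n assume n: "n \<in> ?P"
    have "((\<lambda>d. moebius_mu d / (real n)\<^sup>2) has_sum (\<Sum>d | d dvd n. moebius_mu d / (real n)\<^sup>2)) {d. d dvd n}"
      using n by (intro has_sum_finite) auto
    also have "(\<Sum>d | d dvd n. moebius_mu d / (real n)\<^sup>2) = (if n = 1 then 1 else 0) / (real n)\<^sup>2"
      using n by (simp add: sum_divide_distrib [symmetric] sum_moebius_mu_divisors)
    finally show "((\<lambda>d. case (n, d) of (n, d) \<Rightarrow> moebius_mu d / (real n)\<^sup>2) has_sum
        (if n = 1 then 1 else 0) / (real n)\<^sup>2) {d. d dvd n}" by simp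
  qed
  moreover have "((\<lambda>n. (if n = 1 then 1 else 0) / (real n)\<^sup>2) has_sum 1) ?P"
    by (subst has_sum_cong_neutral[where T = "{1::nat}" and g = "\<lambda>_. 1::real"]) (auto intro: has_sum_finiteI)
  ultimately have "M * zeta 2 = 1" by (rule has_sum_unique)
  then have "M = 1 / zeta 2" by (simp add: zeta_2 field_simps)
  with M show ?thesis by simp
qed

text \<open>For \<open>k > N\<close> the summand is at most \<open>1 / k^2\<close>, hence at most
  \<open>1 / (k - 1) - 1 / k\<close>, and these bounds telescope to \<open>1 / N\<close>.\<close>

lemma moebius_sum_error:
  assumes "N > 0"
  shows "\<bar>(\<Sum>d=1..N. moebius_mu d / (real d)\<^sup>2) - 1 / zeta 2\<bar> \<le> 1 / real N"
proof -
  let ?m = "\<lambda>d. moebius_mu d / (real d)\<^sup>2"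
  \<comment> \<open>The summand at 0 is 0 by the convention for division by zero, so the series may
    start there; the tail after \<open>N\<close> therefore begins at \<open>Suc N\<close>.\<close>
  have "(?m has_sum 1 / zeta 2) UNIV"
    using has_sum_moebius by (rule has_sum_cong_neutral[THEN iffD1, rotated -1]) auto
  then have "?m sums (1 / zeta 2)" by (rule has_sum_imp_sums)
  then have "(\<lambda>n. ?m (n + Suc N)) sums (1 / zeta 2 - (\<Sum>d<Suc N. ?m d))"
    by (rule sums_split_initial_segment)
  also have "(\<Sum>d<Suc N. ?m d) = (\<Sum>d=1..N. ?m d)"
    by (rule sum.mono_neutral_right) (auto simp: less_Suc_eq_le)
  finally have tail: "(\<lambda>n. ?m (n + Suc N)) sums (1 / zeta 2 - (\<Sum>d=1..N. ?m d))" .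
  have "(\<lambda>n. 1 / real (n + N)) \<longlonglongrightarrow> 0"
    by (rule LIMSEQ_ignore_initial_segment[OF lim_1_over_n])
  from telescope_sums'[OF this]
  have telescope: "(\<lambda>n. 1 / real (n + N) - 1 / real (Suc n + N)) sums (1 / real N)" by simp
  have le: "norm (?m (n + Suc N)) \<le> 1 / real (n + N) - 1 / real (Suc n + N)" for n
  proof -
    have "norm (?m (n + Suc N)) \<le> 1 / (real (n + Suc N))\<^sup>2"
      by (simp add: abs_moebius_le divide_right_mono)
    also have "\<dots> \<le> 1 / (real (n + N) * real (Suc n + N))"
      using assms by (intro divide_left_mono) (auto simp: power2_eq_square intro!: mult_right_mono mult_pos_pos)
    also have "\<dots> = 1 / real (n + N) - 1 / real (Suc n + N)"
      using assms by (simp add: field_simps)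
    finally show ?thesis .
  qed
  have "norm (\<Sum>n. ?m (n + Suc N)) \<le> (\<Sum>n. 1 / real (n + N) - 1 / real (Suc n + N))"
    by (rule norm_suminf_le[OF le]) (use telescope in \<open>simp only: sums_iff\<close>)
  then show ?thesis using tail telescope by (simp add: sums_iff abs_minus_commute)
qed

section \<open>Error estimates\<close>

lemma harm_le: "n > 0 \<Longrightarrow> harm n \<le> 1 + ln (real n)"
  \<comment> \<open>\<open>harm n - ln n\<close> decreases from its value 1 at
    \<open>n = 1\<close>.\<close>
  using euler_mascheroni_sequence_decreasing[of 1 n] by (simp add: harm_def)

text \<open>Rounding \<open>X / d\<close> down contributes \<open>X ^ 3 * (1 + ln X)\<close>, and
  the tail of the Moebius series contributes the remaining \<open>X ^ 3\<close>.\<close>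

lemma sum_coprime_pairs_error:
  assumes "X \<ge> 1"
  shows "\<bar>(\<Sum>(p, q)\<in>coprime_pairs (nat \<lfloor>X\<rfloor>). real p * real q) - 1 / (4 * zeta 2) * X ^ 4\<bar>
           \<le> X ^ 3 * (ln X + 2)"
proof -
  define N where "N = nat \<lfloor>X\<rfloor>"
  have N: "N > 0" "real N \<le> X" "X < real N + 1" using assms by (auto simp: N_def)
  have summand: "\<bar>(real d * (\<Sum>i=1..N div d. real i))\<^sup>2 - X ^ 4 / 4 / (real d)\<^sup>2\<bar> \<le> X ^ 3 * (1 / real d)"
    if "d \<in> {1..N}" for d
  proof -
    \<comment> \<open>\<open>m\<close> is the integer part of \<open>y\<close>: rounding
      \<open>X\<close> first does not change it, and \<open>m \<le> y < m + 1\<close>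
      follows.\<close>
    define y where "y = X / real d"
    define m where "m = real (N div d)"
    have d: "real d > 0" "real d \<le> X" using that N by auto
    then have y: "y \<ge> 1" "X = real d * y" by (auto simp: y_def)
    have "d * (N div d) \<le> N" by simp
    then have "real d * m \<le> real N" unfolding m_def by (metis of_nat_le_iff of_nat_mult)
    then have "real d * m \<le> real d * y" using N y by simp
    then have m: "m \<le> y" using d by simp
    have "N < d * (N div d) + d" using that dividend_less_times_div[of d N] by (simp add: add.commute)
    then have "real (N + 1) \<le> real (d * (N div d) + d)" by (simp only: of_nat_le_iff)
    then have "real d * y < real d * (m + 1)" using N y by (simp add: m_def algebra_simps)
    then have m': "y < m + 1" using d by simp
    define T where "T = (\<Sum>i=1..N div d. real i)"
    have "2 * T = m * (m + 1)"
      using double_gauss_sum_from_Suc_0[of "N div d", where 'a = real] by (simp add: T_def m_def)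
    moreover have "m * (m + 1) \<le> y * (y + 1)" using m by (intro mult_mono) (auto simp: m_def)
    moreover have "(y - 1) * y \<le> m * (m + 1)" using m' y by (intro mult_mono) (auto simp: m_def)
    ultimately have "2 * T \<le> y\<^sup>2 + y" "y\<^sup>2 - y \<le> 2 * T"
      by (simp_all add: power2_eq_square algebra_simps)
    then have T: "\<bar>T - y\<^sup>2 / 2\<bar> \<le> y / 2" by linarith
    have "y \<le> y\<^sup>2" using y by (simp add: power2_eq_square)
    then have "\<bar>T + y\<^sup>2 / 2\<bar> \<le> 2 * y\<^sup>2" using T y by linarith
    \<comment> \<open>The difference of the squares of \<open>T\<close> and \<open>y^2 / 2\<close>
      is factored, so the error in \<open>T\<close> is multiplied only by the size of the
      sum.\<close>
    with T have "\<bar>T - y\<^sup>2 / 2\<bar> * \<bar>T + y\<^sup>2 / 2\<bar> \<le> y / 2 * (2 * y\<^sup>2)"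
      using y by (intro mult_mono) auto
    then have "\<bar>T\<^sup>2 - y ^ 4 / 4\<bar> \<le> y ^ 3"
      by (simp add: abs_mult [symmetric] algebra_simps power2_eq_square power3_eq_cube power4_eq_xxxx)
    then have "(real d)\<^sup>2 * \<bar>T\<^sup>2 - y ^ 4 / 4\<bar> \<le> (real d)\<^sup>2 * y ^ 3" by (intro mult_left_mono) auto
    also have "(real d)\<^sup>2 * \<bar>T\<^sup>2 - y ^ 4 / 4\<bar> = \<bar>(real d)\<^sup>2 * (T\<^sup>2 - y ^ 4 / 4)\<bar>"
      by (simp add: abs_mult)
    also have "(real d)\<^sup>2 * (T\<^sup>2 - y ^ 4 / 4) = (real d * T)\<^sup>2 - X ^ 4 / 4 / (real d)\<^sup>2"
      using d by (simp add: y field_simps power2_eq_square power4_eq_xxxx)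
    also have "(real d)\<^sup>2 * y ^ 3 = X ^ 3 * (1 / real d)"
      using d by (simp add: y field_simps power2_eq_square power3_eq_cube)
    finally show ?thesis by (simp add: T_def)
  qed
  let ?S = "\<Sum>d=1..N. moebius_mu d / (real d)\<^sup>2"
  have "(\<Sum>(p, q)\<in>coprime_pairs N. real p * real q) - X ^ 4 / 4 * ?S =
      (\<Sum>d=1..N. moebius_mu d * ((real d * (\<Sum>i=1..N div d. real i))\<^sup>2 - X ^ 4 / 4 / (real d)\<^sup>2))"
    by (simp add: sum_coprime_pairs sum_subtractf sum_distrib_left right_diff_distrib mult.commute)
  also have "\<bar>\<dots>\<bar> \<le> (\<Sum>d=1..N. X ^ 3 * (1 / real d))"
  proof (rule order.trans[OF sum_abs sum_mono])
    fix d assume "d \<in> {1..N}"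
    then show "\<bar>moebius_mu d * ((real d * (\<Sum>i=1..N div d. real i))\<^sup>2 - X ^ 4 / 4 / (real d)\<^sup>2)\<bar>
        \<le> X ^ 3 * (1 / real d)"
      unfolding abs_mult using mult_mono[OF abs_moebius_le summand, of d d] by simp
  qed
  also have "\<dots> = X ^ 3 * harm N"
    by (simp only: sum_distrib_left [symmetric] harm_def inverse_eq_divide)
  also have "\<dots> \<le> X ^ 3 * (1 + ln X)"
  proof -
    have "ln (real N) \<le> ln X" using N by simp
    then show ?thesis using harm_le[OF N(1)] assms by (intro mult_left_mono) auto
  qed
  finally have main: "\<bar>(\<Sum>(p, q)\<in>coprime_pairs N. real p * real q) - X ^ 4 / 4 * ?S\<bar> \<le> X ^ 3 * (1 + ln X)" .
  have "\<bar>X ^ 4 / 4 * ?S - 1 / (4 * zeta 2) * X ^ 4\<bar> = \<bar>X ^ 4 / 4 * (?S - 1 / zeta 2)\<bar>"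
    by (simp add: algebra_simps)
  also have "\<dots> = X ^ 4 / 4 * \<bar>?S - 1 / zeta 2\<bar>" by (simp add: abs_mult)
  also have "\<dots> \<le> X ^ 4 / 4 * (1 / real N)"
    by (intro mult_left_mono moebius_sum_error N(1)) simp
  \<comment> \<open>The 4 cancels the denominator; it is admissible since
    \<open>X < N + 1 \<le> 2 * N\<close>.\<close>
  also have "\<dots> \<le> X ^ 4 / 4 * (4 / X)"
  proof (intro mult_left_mono)
    have "X \<le> 4 * real N" using N by linarith
    then show "1 / real N \<le> 4 / X" using N(1) assms by (simp add: field_simps)
  qed simp
  also have "\<dots> = X ^ 3" using assms by (simp add: power4_eq_xxxx power3_eq_cube)
  finally show ?thesis using main by (simp add: N_def algebra_simps)
qed

text \<open>Passing from \<open>(p - 1) * (q - 1)\<close> to \<open>p * q\<close> adds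
  \<open>p + q - 1\<close>, at most \<open>2 * N\<close>, for each of at most \<open>N^2\<close>
  pairs. This cost of \<open>2 * X ^ 3\<close> raises the constant from 2 to 4.\<close>

lemma card_Omega1_error:
  assumes "X \<ge> 1"
  shows "\<bar>real (card (Omega1 X)) - 1 / (4 * zeta 2) * X ^ 4\<bar> \<le> X ^ 3 * (ln X + 4)"
proof -
  define N where "N = nat \<lfloor>X\<rfloor>"
  have N: "real N \<le> X" using assms by (simp add: N_def)
  have "\<bar>(\<Sum>(p, q)\<in>coprime_pairs N. real p * real q) - real (card (Omega1 X))\<bar>
      = \<bar>\<Sum>x\<in>coprime_pairs N. real (fst x) * real (snd x) - real ((fst x - 1) * (snd x - 1))\<bar>"
    by (simp add: card_Omega1 N_def sum_subtractf case_prod_unfold)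
  also have "\<dots> \<le> real (card (coprime_pairs N)) * (2 * real N)"
  proof (rule order.trans[OF sum_abs sum_bounded_above])
    fix x assume "x \<in> coprime_pairs N"
    then obtain a b where "x = (Suc a, Suc b)" "Suc a \<le> N" "Suc b \<le> N"
      by (auto simp: coprime_pairs_def Suc_le_eq gr0_conv_Suc)
    then show "\<bar>real (fst x) * real (snd x) - real ((fst x - 1) * (snd x - 1))\<bar> \<le> 2 * real N"
      by (simp add: algebra_simps)
  qed
  also have "\<dots> \<le> real (N * N) * (2 * real N)"
  proof (intro mult_right_mono)
    have "card (coprime_pairs N) \<le> card ({1..N} \<times> {1..N})"
      by (intro card_mono coprime_pairs_subset) simp
    then show "real (card (coprime_pairs N)) \<le> real (N * N)" by (simp only: of_nat_le_iff) simp
  qed simp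
  also have "\<dots> = 2 * real N ^ 3" by (simp add: power3_eq_cube)
  also have "\<dots> \<le> 2 * X ^ 3" using N by (simp add: power_mono)
  finally show ?thesis
    using sum_coprime_pairs_error[OF assms] by (simp add: N_def algebra_simps)
qed

theorem proposition3p3:
  shows "(\<lambda>X::real. real (card (Omega1 X)) - 1 / (4 * zeta 2) * X ^ 4)
           \<in> O[at_top](\<lambda>X. X ^ 3 * ln X)
       \<and> (\<lambda>X::real. real (card (Omega1 X))) \<sim>[at_top] (\<lambda>X. 1 / (4 * zeta 2) * X ^ 4)"
proof
  let ?f = "\<lambda>X::real. real (card (Omega1 X))" and ?g = "\<lambda>X::real. 1 / (4 * zeta 2) * X ^ 4"
  show *: "(\<lambda>X. ?f X - ?g X) \<in> O[at_top](\<lambda>X. X ^ 3 * ln X)"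
  \<comment> \<open>For \<open>X \<ge> exp 1\<close> one has \<open>ln X \<ge> 1\<close>, so
    \<open>ln X + 4 \<le> 5 * ln X\<close>.\<close>
  proof (rule bigoI[of _ 5])
    show "\<forall>\<^sub>F X in at_top. norm (?f X - ?g X) \<le> 5 * norm (X ^ 3 * ln X)"
      using eventually_ge_at_top[of "exp 1"]
    proof eventually_elim
      case (elim X)
      then have X: "X \<ge> 1" using exp_ge_add_one_self[of 1] by linarith
      then have "ln X \<ge> 1" using elim by (simp add: ln_ge_iff)
      then have "X ^ 3 * (ln X + 4) \<le> X ^ 3 * (5 * ln X)" using X by (intro mult_left_mono) auto
      also have "\<dots> = 5 * norm (X ^ 3 * ln X)" using X \<open>ln X \<ge> 1\<close> by (simp add: abs_mult)
      finally show ?case using card_Omega1_error[OF X] by simp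
    qed
  qed
  have "zeta 2 \<noteq> 0" by (simp add: zeta_2)
  have "(\<lambda>X::real. X ^ 3 * ln X) \<in> o(\<lambda>X. X ^ 4)" by real_asymp
  then have "(\<lambda>X::real. X ^ 3 * ln X) \<in> o(?g)" using \<open>zeta 2 \<noteq> 0\<close> by simp
  with * have "(\<lambda>X. ?f X - ?g X) \<in> o(?g)" by (rule landau_o.big_small_trans)
  then show "?f \<sim>[at_top] ?g" by (rule smallo_imp_asymp_equiv)
qed

end
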